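(* Let $G$ be a finite connected amply regular graph with parameters $(n,d,\alpha,\beta)$ and diameter at least $4$, and let $\theta_1$ be the smallest eigenvalue of its adjacency matrix. If $2\le\alpha\le 10\beta-12$, then $$\theta_1\ge -d+2.$$
   Context: All graphs are simple and undirected. An amply regular graph with parameters $(n,d,\alpha,\beta)$ is a $d$-regular graph with $n$ vertices such that any two adjacent vertices have exactly $\alpha$ common neighbors and any two vertices at distance $2$ have exactly $\beta$ common neighbors. *)

theory Defs
  imports
    "Graph_Theory.Graph_Theory"
    "Jordan_Normal_Form.Char_Poly"
begin

text \<open>
  A finite simple undirected graph is a \<^locale>\<open>pair_graph\<close>: finitely many vertices and a
  symmetric, irreflexive set of arcs, so that an edge \<open>{u, v}\<close> is the pair of arcs
  \<open>(u, v)\<close> and \<open>(v, u)\<close>. In particular \<open>out_degree\<close> is the usual degree.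
\<close>

text \<open>Length of a shortest walk; its value is \<open>\<infinity>\<close> if there is none.\<close>

definition graph_dist :: "'a pair_pre_digraph \<Rightarrow> 'a \<Rightarrow> 'a \<Rightarrow> ereal" where
  "graph_dist G u v = wf_digraph.\<mu> (with_proj G) (\<lambda>_. 1) u v"

definition graph_diameter :: "'a pair_pre_digraph \<Rightarrow> ereal" where
  "graph_diameter G = (SUP u\<in>pverts G. SUP v\<in>pverts G. graph_dist G u v)"

definition common_neighbors :: "'a pair_pre_digraph \<Rightarrow> 'a \<Rightarrow> 'a \<Rightarrow> 'a set" where
  "common_neighbors G u v = {w \<in> pverts G. (u, w) \<in> parcs G \<and> (v, w) \<in> parcs G}"

locale amply_regular_graph = pair_graph G for G :: "'a pair_pre_digraph" +
  fixes n d \<alpha> \<beta> :: nat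
  assumes card_verts: "card (pverts G) = n"
    and regular: "u \<in> pverts G \<Longrightarrow> out_degree (with_proj G) u = d"
    and adjacent: "(u, v) \<in> parcs G \<Longrightarrow> card (common_neighbors G u v) = \<alpha>"
    and distance_2: "\<lbrakk>u \<in> pverts G; v \<in> pverts G; graph_dist G u v = 2\<rbrakk>
      \<Longrightarrow> card (common_neighbors G u v) = \<beta>"

text \<open>
  The adjacency matrix with respect to an enumeration \<open>vs\<close> of the vertices without repetition;
  its spectrum does not depend on \<open>vs\<close>. As it is real symmetric, all its eigenvalues are real, so
  that nothing is lost by taking it over the reals.
\<close>

definition adjacency_mat :: "'a pair_pre_digraph \<Rightarrow> 'a list \<Rightarrow> real mat" where
  "adjacency_mat G vs =
    mat (length vs) (length vs) (\<lambda>(i, j). if (vs ! i, vs ! j) \<in> parcs G then 1 else 0)"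

definition is_smallest_eigenvalue :: "real mat \<Rightarrow> real \<Rightarrow> bool" where
  "is_smallest_eigenvalue A \<theta> \<longleftrightarrow> eigenvalue A \<theta> \<and> (\<forall>k. eigenvalue A k \<longrightarrow> \<theta> \<le> k)"

end

theory Submission
  imports Defs
begin

text \<open>
  Every edge lies in \<open>\<alpha>\<close> triangles and every vertex in \<open>d \<alpha> / 2\<close> triangles, so expanding
  \<open>0 \<le> \<Sum> (f x + f y + f z)\<^sup>2\<close> over all triangles shows that \<open>A + d/2\<close> is positive semidefinite as
  soon as \<open>\<alpha> > 0\<close>; hence \<open>\<theta>\<^sub>1 \<ge> -d/2\<close>. If \<open>d \<le> \<alpha> + 1\<close>, adjacent vertices have the same closed
  neighborhood and a connected graph is complete; so here \<open>d \<ge> \<alpha> + 2 \<ge> 4\<close> and \<open>-d/2 \<ge> -d + 2\<close>.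
\<close>

lemma (in pair_graph) graph_dist_arc_le_1:
  assumes "(u, v) \<in> parcs G"
  shows "graph_dist G u v \<le> 1"
proof -
  have "awalk u [(u, v)] v"
    using assms by (auto simp: awalk_Cons_iff awalk_Nil_iff intro: wellformed')
  from min_cost_le_walk_cost[OF this, of "\<lambda>_. 1"] show ?thesis
    by (simp add: graph_dist_def awalk_cost_def one_ereal_def)
qed

lemma (in pair_graph) graph_dist_self_le_0:
  assumes "u \<in> pverts G"
  shows "graph_dist G u u \<le> 0"
proof -
  have "awalk u [] u"
    using assms by (simp add: awalk_Nil_iff)
  from min_cost_le_walk_cost[OF this, of "\<lambda>_. 1"] show ?thesis
    by (simp add: graph_dist_def awalk_cost_def zero_ereal_def)
qed

text \<open>Loops have distance at most 0 and arcs at most 1, so a pair at distance above 1, finite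
  or not, is neither equal nor adjacent.\<close>

lemma (in pair_graph) nonadjacent_of_diameter_gt_1:
  assumes "graph_diameter G > 1"
  obtains u v where "u \<in> pverts G" "v \<in> pverts G" "u \<noteq> v" "(u, v) \<notin> parcs G"
proof -
  obtain u v where uv: "u \<in> pverts G" "v \<in> pverts G" "graph_dist G u v > 1"
    using assms by (auto simp: graph_diameter_def less_SUP_iff)
  moreover have "u \<noteq> v"
    using uv graph_dist_self_le_0[of u] by (auto dest: order.strict_trans2)
  moreover have "(u, v) \<notin> parcs G"
    using uv graph_dist_arc_le_1[of u v] by auto
  ultimately show ?thesis using that by blast
qed

lemma (in pair_graph) out_degree_eq_card:
  "out_degree (with_proj G) u = card {v \<in> pverts G. (u, v) \<in> parcs G}"
proof -
  have "out_arcs (with_proj G) u = Pair u ` {v \<in> pverts G. (u, v) \<in> parcs G}"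
    by (auto simp: out_arcs_def intro: wellformed')
  then show ?thesis
    by (simp add: out_degree_def card_image inj_on_def)
qed

context amply_regular_graph
begin

lemma degree_ge_of_nonadjacent:
  assumes conn: "connected (with_proj G)"
    and uv: "u \<in> pverts G" "v \<in> pverts G" "u \<noteq> v" "(u, v) \<notin> parcs G"
  shows "\<alpha> + 2 \<le> d"
proof (rule ccontr)
  assume "\<not> \<alpha> + 2 \<le> d"
  then have d: "d \<le> \<alpha> + 1" by simp
  have fin: "finite (pverts G)" by (rule pair_finite_verts)
  have "u \<rightarrow>\<^sup>*\<^bsub>with_proj G\<^esub> v"
    using conn uv reachable_mk_symmetric_eq[OF sym_arcs, of u v]
    by (simp add: connected_def strongly_connected_def)
  \<comment> \<open>Induction along a walk from \<open>u\<close>: the closed neighborhood of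
    \<open>u\<close> cannot be left.\<close>
  then have "v = u \<or> (u, v) \<in> parcs G"
  proof (induction rule: reachable_induct)
    case base
    then show ?case by simp
  next
    case (step y z)
    from step.hyps have yz: "(y, z) \<in> parcs G"
      by simp
    show ?case
    proof (cases "y = u")
      case True
      then show ?thesis using yz by simp
    next
      case False
      with step.IH have uy: "(u, y) \<in> parcs G" by simp
      let ?N = "{w \<in> pverts G. (y, w) \<in> parcs G}"
      have cn: "card (common_neighbors G u y) = \<alpha>" using uy by (rule adjacent)
      \<comment> \<open>There are no loops, so adding \<open>u\<close> really yields one more
        element.\<close>
      have "u \<notin> common_neighbors G u y" "finite (common_neighbors G u y)"
        using fin by (auto simp: common_neighbors_def dest: no_loops')
      then have "card (insert u (common_neighbors G u y)) = \<alpha> + 1"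
        using cn by simp
      moreover have "card ?N = d"
        using regular[of y] uy by (simp add: out_degree_eq_card wellformed')
      moreover have "insert u (common_neighbors G u y) \<subseteq> ?N"
        using uy uv arcs_symmetric by (auto simp: common_neighbors_def)
      \<comment> \<open>These \<alpha> + 1 \<ge> d neighbors of \<open>y\<close> exhaust its d
        neighbors, so the next vertex \<open>z\<close> is \<open>u\<close> or adjacent to
        \<open>u\<close>.\<close>
      ultimately have "insert u (common_neighbors G u y) = ?N"
        using d fin by (intro card_seteq) auto
      moreover have "z \<in> ?N" using yz by (auto intro: wellformed')
      ultimately show ?thesis by (auto simp: common_neighbors_def)
    qed
  qed
  with uv show False by auto
qed

lemma quadratic_form_ge:
  fixes f :: "'a \<Rightarrow> real"
  assumes "\<alpha> > 0"
  shows "(\<Sum>x\<in>pverts G. \<Sum>y\<in>pverts G. of_bool ((x, y) \<in> parcs G) * (f x * f y))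
    \<ge> - (real d / 2) * (\<Sum>x\<in>pverts G. (f x)\<^sup>2)"
proof -
  let ?V = "pverts G"
  have fin: "finite ?V" by (rule pair_finite_verts)
  define a where "a x y = (of_bool ((x, y) \<in> parcs G) :: real)" for x y
  have a_sym: "a x y = a y x" for x y
    using arcs_symmetric by (auto simp: a_def)
  \<comment> \<open>Sum of \<open>F\<close> over ordered triangles: the weight is 1 if
    \<open>x\<close>, \<open>y\<close>, \<open>z\<close> are pairwise adjacent and 0 otherwise, so
    each triangle occurs six times.\<close>
  define T where "T F = (\<Sum>x\<in>?V. \<Sum>y\<in>?V. \<Sum>z\<in>?V. a x y * a y z * a x z * F x y z)"
    for F :: "'a \<Rightarrow> 'a \<Rightarrow> 'a \<Rightarrow> real"
  \<comment> \<open>The weight is symmetric, so arguments of \<open>F\<close> may be permuted. These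
    two transpositions reduce all squares and all products to one of each.\<close>
  have T_swap12: "T F = T (\<lambda>x y z. F y x z)" for F
    unfolding T_def by (subst sum.swap) (simp add: a_sym mult_ac)
  have T_swap23: "T F = T (\<lambda>x y z. F x z y)" for F
    unfolding T_def by (subst (2) sum.swap) (simp add: a_sym mult_ac)
  \<comment> \<open>The factor \<open>a x y\<close> makes both sides vanish on non-adjacent pairs,
    about which \<open>adjacent\<close> says nothing.\<close>
  have common: "(\<Sum>z\<in>?V. a x y * a y z * a x z) = \<alpha> * a x y" for x y
  proof (cases "(x, y) \<in> parcs G")
    case True
    have "(\<Sum>z\<in>?V. a x y * a y z * a x z) = (\<Sum>z\<in>?V. of_bool (z \<in> common_neighbors G x y))"
      using True by (intro sum.cong) (auto simp: a_def common_neighbors_def)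
    also have "\<dots> = card (common_neighbors G x y)"
      using fin by (simp add: common_neighbors_def Int_def conj_ac)
    finally show ?thesis using True adjacent[OF True] by (simp add: a_def)
  qed (simp add: a_def)
  have T_pair: "T (\<lambda>x y z. g x y) = \<alpha> * (\<Sum>x\<in>?V. \<Sum>y\<in>?V. a x y * g x y)"
    for g :: "'a \<Rightarrow> 'a \<Rightarrow> real"
    unfolding T_def sum_distrib_right[symmetric] common
    by (simp add: sum_distrib_left mult.assoc)
  have deg: "(\<Sum>y\<in>?V. a x y) = d" if "x \<in> ?V" for x
    using regular[OF that] fin by (simp add: a_def out_degree_eq_card Int_def conj_ac)
  define S where "S = (\<Sum>x\<in>?V. (f x)\<^sup>2)"
  define Q where "Q = (\<Sum>x\<in>?V. \<Sum>y\<in>?V. a x y * (f x * f y))"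
  have sq: "T (\<lambda>x y z. (f x)\<^sup>2) = \<alpha> * (d * S)"
    by (subst T_pair) (simp add: sum_distrib_right[symmetric] deg S_def sum_distrib_left)
  have sq2: "T (\<lambda>x y z. (f y)\<^sup>2) = \<alpha> * (d * S)"
    by (subst T_swap12) (rule sq)
  have sq3: "T (\<lambda>x y z. (f z)\<^sup>2) = \<alpha> * (d * S)"
    by (subst T_swap23) (rule sq2)
  have pr: "T (\<lambda>x y z. f x * f y) = \<alpha> * Q"
    by (subst T_pair) (simp add: Q_def)
  have pr2: "T (\<lambda>x y z. f x * f z) = \<alpha> * Q"
    by (subst T_swap23) (rule pr)
  have pr3: "T (\<lambda>x y z. f y * f z) = \<alpha> * Q"
    by (subst T_swap12) (rule pr2)
  have "0 \<le> T (\<lambda>x y z. (f x + f y + f z)\<^sup>2)"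
    unfolding T_def by (intro sum_nonneg mult_nonneg_nonneg) (auto simp: a_def)
  also have "\<dots> = T (\<lambda>x y z. (f x)\<^sup>2) + T (\<lambda>x y z. (f y)\<^sup>2) + T (\<lambda>x y z. (f z)\<^sup>2)
      + 2 * (T (\<lambda>x y z. f x * f y) + T (\<lambda>x y z. f x * f z) + T (\<lambda>x y z. f y * f z))"
    unfolding T_def
    by (simp add: sum.distrib[symmetric] sum_distrib_left power2_eq_square algebra_simps)
  \<comment> \<open>Three squares contribute \<alpha> d S each and three doubled products 2 \<alpha>
    Q each; \<alpha> > 0 then cancels.\<close>
  also have "\<dots> = 3 * (\<alpha> * (d * S + 2 * Q))"
    by (simp add: sq sq2 sq3 pr pr2 pr3 algebra_simps)
  finally have "0 \<le> d * S + 2 * Q"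
    using assms by (simp add: zero_le_mult_iff)
  then show ?thesis by (simp add: Q_def S_def a_def)
qed

text \<open>At an eigenvector the quadratic form equals \<theta> times the squared norm, so the
  bound on the form becomes a bound on \<theta>.\<close>

lemma eigenvalue_ge:
  assumes "\<alpha> > 0" and vs: "distinct vs" "set vs = pverts G"
    and ev: "eigenvalue (adjacency_mat G vs) \<theta>"
  shows "\<theta> \<ge> - (real d / 2)"
proof -
  let ?A = "adjacency_mat G vs" and ?m = "length vs"
  obtain w where w: "w \<in> carrier_vec ?m" "w \<noteq> 0\<^sub>v ?m" "?A *\<^sub>v w = \<theta> \<cdot>\<^sub>v w"
    using ev by (auto simp: eigenvalue_def eigenvector_def adjacency_mat_def)
  have bij: "bij_betw ((!) vs) {..<?m} (pverts G)"
    using vs by (intro bij_betw_nth) auto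
  \<comment> \<open>The eigenvector carried from indices to vertices; only values on vertices
    matter.\<close>
  define f where "f x = w $ the_inv_into {..<?m} ((!) vs) x" for x
  have f_nth: "f (vs ! i) = w $ i" if "i < ?m" for i
    using that bij by (simp add: f_def the_inv_into_f_f bij_betw_def)
  have row: "(\<Sum>j<?m. of_bool ((vs ! i, vs ! j) \<in> parcs G) * w $ j) = \<theta> * w $ i"
    if "i < ?m" for i
  proof -
    have "(?A *\<^sub>v w) $ i = (\<Sum>j<?m. of_bool ((vs ! i, vs ! j) \<in> parcs G) * w $ j)"
      using that carrier_vecD[OF w(1)]
      by (simp add: adjacency_mat_def scalar_prod_def atLeast0LessThan of_bool_def)
    then show ?thesis using that w by simp
  qed
  have S: "(\<Sum>x\<in>pverts G. (f x)\<^sup>2) = (\<Sum>i<?m. (w $ i)\<^sup>2)"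
    by (simp add: sum.reindex_bij_betw[OF bij, symmetric] f_nth)
  have "(\<Sum>x\<in>pverts G. \<Sum>y\<in>pverts G. of_bool ((x, y) \<in> parcs G) * (f x * f y))
      = (\<Sum>i<?m. w $ i * (\<Sum>j<?m. of_bool ((vs ! i, vs ! j) \<in> parcs G) * w $ j))"
    \<comment> \<open>The deleted rules would absorb the 0/1 weights into the index sets; they have
      to stay factors to match \<open>row\<close>.\<close>
    by (simp add: sum.reindex_bij_betw[OF bij, symmetric] f_nth sum_distrib_left mult_ac
        del: sum_of_bool_mult_eq sum_mult_of_bool_eq)
  also have "\<dots> = \<theta> * (\<Sum>i<?m. (w $ i)\<^sup>2)"
    unfolding sum_distrib_left
    by (intro sum.cong refl) (subst sum_distrib_left[symmetric], subst row, auto simp: power2_eq_square)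
  finally have "- (real d / 2) * (\<Sum>i<?m. (w $ i)\<^sup>2) \<le> \<theta> * (\<Sum>i<?m. (w $ i)\<^sup>2)"
    using quadratic_form_ge[OF \<open>\<alpha> > 0\<close>, of f] S by simp
  \<comment> \<open>A nonzero entry makes the squared norm positive, so it can be cancelled.\<close>
  moreover obtain i where "i < ?m" "w $ i \<noteq> 0"
    using w by (metis carrier_vecD eq_vecI index_zero_vec)
  then have "(\<Sum>i<?m. (w $ i)\<^sup>2) > 0"
    by (intro sum_pos2[of _ i]) auto
  ultimately show ?thesis by (simp only: mult_le_cancel_right_pos)
qed

end

theorem theorem1p7:
  fixes G :: "'a pair_pre_digraph"
    and vs :: "'a list"
    and n d \<alpha> \<beta> :: nat
    and \<theta>\<^sub>1 :: real
  assumes "amply_regular_graph G n d \<alpha> \<beta>"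
    and "connected (with_proj G)"
    and "graph_diameter G \<ge> 4"
    and "distinct vs" and "set vs = pverts G"
    and "is_smallest_eigenvalue (adjacency_mat G vs) \<theta>\<^sub>1"
    and "2 \<le> \<alpha>" and "int \<alpha> \<le> 10 * int \<beta> - 12"
  shows "\<theta>\<^sub>1 \<ge> - real d + 2"
proof -
  interpret amply_regular_graph G n d \<alpha> \<beta> by fact
  have "(1::ereal) < 4" by simp
  with \<open>graph_diameter G \<ge> 4\<close> have "graph_diameter G > 1"
    by (rule order.strict_trans2[rotated])
  then obtain u v where "u \<in> pverts G" "v \<in> pverts G" "u \<noteq> v" "(u, v) \<notin> parcs G"
    by (rule nonadjacent_of_diameter_gt_1)
  then have "\<alpha> + 2 \<le> d"
    by (rule degree_ge_of_nonadjacent[OF \<open>connected (with_proj G)\<close>])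
  moreover have "\<theta>\<^sub>1 \<ge> - (real d / 2)"
    using assms by (intro eigenvalue_ge[of vs]) (auto simp: is_smallest_eigenvalue_def)
  \<comment> \<open>The claim -d/2 \<ge> -d + 2 amounts to d \<ge> 4, which follows from d \<ge>
    \<alpha> + 2.\<close>
  ultimately show ?thesis using \<open>2 \<le> \<alpha>\<close> by simp
qed

end
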